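(* Let $T^*$ be a theory in the language of category theory plus constants whose constants form a set, let $M$ be a model for $T^*$, and let $FP=FP_{T^*,M}$. Then the set $\{\phi\mid FP(\phi)\}$ of sentences is closed under logical deduction: if sentences $\phi_1,\dots,\phi_n$ satisfy $FP(\phi_i)$ for all $i$ and $\psi$ is derivable from $\phi_1,\dots,\phi_n$ in intuitionistic (natural deduction) dependently sorted logic together with the axioms that each equality $=$ is an equivalence relation preserved by composition, then $FP(\psi)$.
   Context: The language of category theory is a dependently sorted first-order language with an object sort, arrow sorts $X\to Y$, identities $1_X$, composition, atomic formulas $f=g$ only for arrow-terms of the same sort, connectives $\wedge,\vee,\to,\top,\bot$ and sorted quantifiers; theories may have object and arrow constants. A model for $T^*$ is a set $M$ of atomic sentences $f_1=f_2$ between closed arrow-terms of the same sort such that (1) $T^*\vdash f_1=f_2$ for each member; (2) for object constants $S_1,S_2$, membership in $M$ is an equivalence relation on closed arrow-terms $S_1\to S_2$; (3) $M$ is closed under composing equal pairs: $(f_1=f_2),(g_1=g_2)\in M$ implies $(g_1\circ f_1=g_2\circ f_2)\in M$. $FP$ is defined recursively on sentences: $FP(f_1=f_2)$ iff $(f_1=f_2)\in M$; $FP$ commutes with $\wedge,\vee$; $FP(\phi\to\xi)$ iff ($FP(\phi)\Rightarrow FP(\xi)$) and $T^*\vdash\phi\to\xi$; $FP(\top)$ true, $FP(\bot)$ false; $FP(\exists x{:}W\,P(x))$ iff $FP(P(t))$ for some closed term $t$ of sort $W$; $FP(\forall x{:}W\,P(x))$ iff $FP(P(t))$ for every closed term $t$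 of sort $W$ and $T^*\vdash\forall x{:}W\,P(x)$. *)

theory Defs
  imports Main
begin

text \<open>
  Formulas are taken up to renaming of bound variables, using de Bruijn indices. Object variables
  and arrow variables have separate index spaces, so \<^verbatim>\<open>AllO\<close>/\<^verbatim>\<open>ExO\<close> bind object index 0 and
  \<^verbatim>\<open>AllA X Y\<close>/\<^verbatim>\<open>ExA X Y\<close> (quantifiers over the sort X \<rightarrow> Y) bind arrow index 0. The endpoints X, Y
  lie outside the scope of that binder. The only object terms are variables and constants, and
  there is no equality between objects.
\<close>

datatype 'o obj = OVar nat | OCon 'o

datatype ('o, 'a) arr =
    AVar nat
  | ACon 'a
  | Ident "'o obj"
  | Comp "('o, 'a) arr" "('o, 'a) arr"  (infixr \<open>\<cdot>\<close> 75)  \<comment> \<open>\<^verbatim>\<open>g \<cdot> f\<close> is g after f\<close>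

datatype ('o, 'a) fm =
    Eq "('o, 'a) arr" "('o, 'a) arr"  (infix \<open>\<doteq>\<close> 60)
  | Top
  | Bot
  | And "('o, 'a) fm" "('o, 'a) fm"
  | Or "('o, 'a) fm" "('o, 'a) fm"
  | Imp "('o, 'a) fm" "('o, 'a) fm"
  | AllO "('o, 'a) fm"
  | ExO "('o, 'a) fm"
  | AllA "'o obj" "'o obj" "('o, 'a) fm"
  | ExA "'o obj" "'o obj" "('o, 'a) fm"

record ('o, 'a) cat_sig =
  obj_consts :: "'o set"
  arr_consts :: "'a set"
  src :: "'a \<Rightarrow> 'o"
  tgt :: "'a \<Rightarrow> 'o"

record ('o, 'a) cat_theory = "('o, 'a) cat_sig" +
  axioms :: "('o, 'a) fm set"


primrec osubst :: "(nat \<Rightarrow> 'o obj) \<Rightarrow> 'o obj \<Rightarrow> 'o obj" where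
  "osubst \<sigma> (OVar i) = \<sigma> i"
| "osubst \<sigma> (OCon c) = OCon c"

primrec asubst :: "(nat \<Rightarrow> 'o obj) \<Rightarrow> (nat \<Rightarrow> ('o, 'a) arr) \<Rightarrow> ('o, 'a) arr \<Rightarrow> ('o, 'a) arr" where
  "asubst \<sigma> \<tau> (AVar i) = \<tau> i"
| "asubst \<sigma> \<tau> (ACon c) = ACon c"
| "asubst \<sigma> \<tau> (Ident X) = Ident (osubst \<sigma> X)"
| "asubst \<sigma> \<tau> (g \<cdot> f) = asubst \<sigma> \<tau> g \<cdot> asubst \<sigma> \<tau> f"

abbreviation oshift :: "'o obj \<Rightarrow> 'o obj" where
  "oshift \<equiv> osubst (\<lambda>i. OVar (Suc i))"

primrec fsubst :: "(nat \<Rightarrow> 'o obj) \<Rightarrow> (nat \<Rightarrow> ('o, 'a) arr) \<Rightarrow> ('o, 'a) fm \<Rightarrow> ('o, 'a) fm" where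
  "fsubst \<sigma> \<tau> (f \<doteq> g) = (asubst \<sigma> \<tau> f \<doteq> asubst \<sigma> \<tau> g)"
| "fsubst \<sigma> \<tau> Top = Top"
| "fsubst \<sigma> \<tau> Bot = Bot"
| "fsubst \<sigma> \<tau> (And \<phi> \<psi>) = And (fsubst \<sigma> \<tau> \<phi>) (fsubst \<sigma> \<tau> \<psi>)"
| "fsubst \<sigma> \<tau> (Or \<phi> \<psi>) = Or (fsubst \<sigma> \<tau> \<phi>) (fsubst \<sigma> \<tau> \<psi>)"
| "fsubst \<sigma> \<tau> (Imp \<phi> \<psi>) = Imp (fsubst \<sigma> \<tau> \<phi>) (fsubst \<sigma> \<tau> \<psi>)"
| "fsubst \<sigma> \<tau> (AllO \<phi>) =
     AllO (fsubst (case_nat (OVar 0) (\<lambda>i. oshift (\<sigma> i)))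
                  (\<lambda>i. asubst (\<lambda>j. OVar (Suc j)) AVar (\<tau> i)) \<phi>)"
| "fsubst \<sigma> \<tau> (ExO \<phi>) =
     ExO (fsubst (case_nat (OVar 0) (\<lambda>i. oshift (\<sigma> i)))
                 (\<lambda>i. asubst (\<lambda>j. OVar (Suc j)) AVar (\<tau> i)) \<phi>)"
| "fsubst \<sigma> \<tau> (AllA X Y \<phi>) =
     AllA (osubst \<sigma> X) (osubst \<sigma> Y)
       (fsubst \<sigma> (case_nat (AVar 0) (\<lambda>i. asubst OVar (\<lambda>j. AVar (Suc j)) (\<tau> i))) \<phi>)"
| "fsubst \<sigma> \<tau> (ExA X Y \<phi>) =
     ExA (osubst \<sigma> X) (osubst \<sigma> Y)
       (fsubst \<sigma> (case_nat (AVar 0) (\<lambda>i. asubst OVar (\<lambda>j. AVar (Suc j)) (\<tau> i))) \<phi>)"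

definition inst_obj :: "'o obj \<Rightarrow> ('o, 'a) fm \<Rightarrow> ('o, 'a) fm" where
  "inst_obj X = fsubst (case_nat X OVar) AVar"

definition inst_arr :: "('o, 'a) arr \<Rightarrow> ('o, 'a) fm \<Rightarrow> ('o, 'a) fm" where
  "inst_arr t = fsubst OVar (case_nat t AVar)"

definition weaken_obj :: "('o, 'a) fm \<Rightarrow> ('o, 'a) fm" where
  "weaken_obj = fsubst (\<lambda>i. OVar (Suc i)) AVar"

definition weaken_arr :: "('o, 'a) fm \<Rightarrow> ('o, 'a) fm" where
  "weaken_arr = fsubst OVar (\<lambda>i. AVar (Suc i))"


text \<open>
  A context consists of a number \<^verbatim>\<open>n\<close> of object variables and a list \<^verbatim>\<open>\<Gamma>\<close> giving the sorts X \<rightarrow> Y of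
  the arrow variables. Since the object sort depends on nothing, declaring all object variables
  before the arrow variables loses no contexts.
\<close>

type_synonym 'o ctx = "('o obj \<times> 'o obj) list"

definition ctx_shift :: "'o ctx \<Rightarrow> 'o ctx" where
  "ctx_shift = map (map_prod oshift oshift)"

primrec wf_obj :: "('o, 'a, 'x) cat_sig_scheme \<Rightarrow> nat \<Rightarrow> 'o obj \<Rightarrow> bool" where
  "wf_obj L n (OVar i) \<longleftrightarrow> i < n"
| "wf_obj L n (OCon c) \<longleftrightarrow> c \<in> obj_consts L"

inductive has_sort ::
  "('o, 'a, 'x) cat_sig_scheme \<Rightarrow> nat \<Rightarrow> 'o ctx \<Rightarrow> ('o, 'a) arr \<Rightarrow> 'o obj \<Rightarrow> 'o obj \<Rightarrow> bool"
  for L :: "('o, 'a, 'x) cat_sig_scheme" and n :: nat and \<Gamma> :: "'o ctx" where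
  sort_var: "i < length \<Gamma> \<Longrightarrow> \<Gamma> ! i = (X, Y) \<Longrightarrow> has_sort L n \<Gamma> (AVar i) X Y"
| sort_con: "c \<in> arr_consts L \<Longrightarrow> has_sort L n \<Gamma> (ACon c) (OCon (src L c)) (OCon (tgt L c))"
| sort_ident: "wf_obj L n X \<Longrightarrow> has_sort L n \<Gamma> (Ident X) X X"
| sort_comp: "has_sort L n \<Gamma> f X Y \<Longrightarrow> has_sort L n \<Gamma> g Y Z \<Longrightarrow> has_sort L n \<Gamma> (g \<cdot> f) X Z"

primrec wf_fm :: "('o, 'a, 'x) cat_sig_scheme \<Rightarrow> nat \<Rightarrow> 'o ctx \<Rightarrow> ('o, 'a) fm \<Rightarrow> bool" where
  "wf_fm L n \<Gamma> (f \<doteq> g) \<longleftrightarrow> (\<exists>X Y. has_sort L n \<Gamma> f X Y \<and> has_sort L n \<Gamma> g X Y)"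
| "wf_fm L n \<Gamma> Top \<longleftrightarrow> True"
| "wf_fm L n \<Gamma> Bot \<longleftrightarrow> True"
| "wf_fm L n \<Gamma> (And \<phi> \<psi>) \<longleftrightarrow> wf_fm L n \<Gamma> \<phi> \<and> wf_fm L n \<Gamma> \<psi>"
| "wf_fm L n \<Gamma> (Or \<phi> \<psi>) \<longleftrightarrow> wf_fm L n \<Gamma> \<phi> \<and> wf_fm L n \<Gamma> \<psi>"
| "wf_fm L n \<Gamma> (Imp \<phi> \<psi>) \<longleftrightarrow> wf_fm L n \<Gamma> \<phi> \<and> wf_fm L n \<Gamma> \<psi>"
| "wf_fm L n \<Gamma> (AllO \<phi>) \<longleftrightarrow> wf_fm L (Suc n) (ctx_shift \<Gamma>) \<phi>"
| "wf_fm L n \<Gamma> (ExO \<phi>) \<longleftrightarrow> wf_fm L (Suc n) (ctx_shift \<Gamma>) \<phi>"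
| "wf_fm L n \<Gamma> (AllA X Y \<phi>) \<longleftrightarrow> wf_obj L n X \<and> wf_obj L n Y \<and> wf_fm L n ((X, Y) # \<Gamma>) \<phi>"
| "wf_fm L n \<Gamma> (ExA X Y \<phi>) \<longleftrightarrow> wf_obj L n X \<and> wf_obj L n Y \<and> wf_fm L n ((X, Y) # \<Gamma>) \<phi>"

abbreviation closed_obj :: "('o, 'a, 'x) cat_sig_scheme \<Rightarrow> 'o obj \<Rightarrow> bool" where
  "closed_obj L \<equiv> wf_obj L 0"

abbreviation closed_arr ::
  "('o, 'a, 'x) cat_sig_scheme \<Rightarrow> ('o, 'a) arr \<Rightarrow> 'o obj \<Rightarrow> 'o obj \<Rightarrow> bool" where
  "closed_arr L \<equiv> has_sort L 0 []"

abbreviation sentence :: "('o, 'a, 'x) cat_sig_scheme \<Rightarrow> ('o, 'a) fm \<Rightarrow> bool" where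
  "sentence L \<equiv> wf_fm L 0 []"


text \<open>
  Reflexivity, symmetry, transitivity, and preservation by composition
  (\<forall>X Y Z. \<forall>f f' : X \<rightarrow> Y. \<forall>g g' : Y \<rightarrow> Z. f = f' \<and> g = g' \<rightarrow> g f = g' f').
  Associativity and the unit laws are not among them.
\<close>

definition equality_axioms :: "('o, 'a) fm set" where
  "equality_axioms =
   {AllO (AllO (AllA (OVar 1) (OVar 0) (AVar 0 \<doteq> AVar 0))),
    AllO (AllO (AllA (OVar 1) (OVar 0) (AllA (OVar 1) (OVar 0)
      (Imp (AVar 1 \<doteq> AVar 0) (AVar 0 \<doteq> AVar 1))))),
    AllO (AllO (AllA (OVar 1) (OVar 0) (AllA (OVar 1) (OVar 0) (AllA (OVar 1) (OVar 0)
      (Imp (And (AVar 2 \<doteq> AVar 1) (AVar 1 \<doteq> AVar 0)) (AVar 2 \<doteq> AVar 0)))))),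
    AllO (AllO (AllO
      (AllA (OVar 2) (OVar 1) (AllA (OVar 2) (OVar 1)
      (AllA (OVar 1) (OVar 0) (AllA (OVar 1) (OVar 0)
        (Imp (And (AVar 3 \<doteq> AVar 2) (AVar 1 \<doteq> AVar 0))
             (AVar 1 \<cdot> AVar 3 \<doteq> AVar 0 \<cdot> AVar 2))))))))}"

text \<open>
  \<^verbatim>\<open>derives L n \<Gamma> \<Delta> \<phi>\<close>: from the hypotheses \<^verbatim>\<open>\<Delta>\<close> one derives \<^verbatim>\<open>\<phi>\<close>, all in the context \<^verbatim>\<open>n\<close>, \<^verbatim>\<open>\<Gamma>\<close>.
  The context is tracked because sorts may be empty: an instance of a quantifier must be a term
  over the current context, so \<forall>x. P does not entail \<exists>x. P without a term of the right sort.
\<close>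

inductive derives ::
  "('o, 'a, 'x) cat_sig_scheme \<Rightarrow> nat \<Rightarrow> 'o ctx \<Rightarrow> ('o, 'a) fm set \<Rightarrow> ('o, 'a) fm \<Rightarrow> bool"
  for L :: "('o, 'a, 'x) cat_sig_scheme" where
  Hyp: "\<phi> \<in> \<Delta> \<Longrightarrow> wf_fm L n \<Gamma> \<phi> \<Longrightarrow> derives L n \<Gamma> \<Delta> \<phi>"
| EqAx: "\<phi> \<in> equality_axioms \<Longrightarrow> derives L n \<Gamma> \<Delta> \<phi>"
| TopI: "derives L n \<Gamma> \<Delta> Top"
| BotE: "derives L n \<Gamma> \<Delta> Bot \<Longrightarrow> wf_fm L n \<Gamma> \<phi> \<Longrightarrow> derives L n \<Gamma> \<Delta> \<phi>"
| AndI: "derives L n \<Gamma> \<Delta> \<phi> \<Longrightarrow> derives L n \<Gamma> \<Delta> \<psi> \<Longrightarrow> derives L n \<Gamma> \<Delta> (And \<phi> \<psi>)"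
| AndE1: "derives L n \<Gamma> \<Delta> (And \<phi> \<psi>) \<Longrightarrow> derives L n \<Gamma> \<Delta> \<phi>"
| AndE2: "derives L n \<Gamma> \<Delta> (And \<phi> \<psi>) \<Longrightarrow> derives L n \<Gamma> \<Delta> \<psi>"
| OrI1: "derives L n \<Gamma> \<Delta> \<phi> \<Longrightarrow> wf_fm L n \<Gamma> \<psi> \<Longrightarrow> derives L n \<Gamma> \<Delta> (Or \<phi> \<psi>)"
| OrI2: "derives L n \<Gamma> \<Delta> \<psi> \<Longrightarrow> wf_fm L n \<Gamma> \<phi> \<Longrightarrow> derives L n \<Gamma> \<Delta> (Or \<phi> \<psi>)"
| OrE: "derives L n \<Gamma> \<Delta> (Or \<phi> \<psi>) \<Longrightarrow> derives L n \<Gamma> (insert \<phi> \<Delta>) \<chi> \<Longrightarrow>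
    derives L n \<Gamma> (insert \<psi> \<Delta>) \<chi> \<Longrightarrow> derives L n \<Gamma> \<Delta> \<chi>"
| ImpI: "wf_fm L n \<Gamma> \<phi> \<Longrightarrow> derives L n \<Gamma> (insert \<phi> \<Delta>) \<psi> \<Longrightarrow> derives L n \<Gamma> \<Delta> (Imp \<phi> \<psi>)"
| ImpE: "derives L n \<Gamma> \<Delta> (Imp \<phi> \<psi>) \<Longrightarrow> derives L n \<Gamma> \<Delta> \<phi> \<Longrightarrow> derives L n \<Gamma> \<Delta> \<psi>"
| AllOI: "derives L (Suc n) (ctx_shift \<Gamma>) (weaken_obj ` \<Delta>) \<phi> \<Longrightarrow> derives L n \<Gamma> \<Delta> (AllO \<phi>)"
| AllOE: "derives L n \<Gamma> \<Delta> (AllO \<phi>) \<Longrightarrow> wf_obj L n X \<Longrightarrow> derives L n \<Gamma> \<Delta> (inst_obj X \<phi>)"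
| ExOI: "wf_fm L n \<Gamma> (ExO \<phi>) \<Longrightarrow> wf_obj L n X \<Longrightarrow> derives L n \<Gamma> \<Delta> (inst_obj X \<phi>) \<Longrightarrow>
    derives L n \<Gamma> \<Delta> (ExO \<phi>)"
| ExOE: "derives L n \<Gamma> \<Delta> (ExO \<phi>) \<Longrightarrow> wf_fm L n \<Gamma> \<chi> \<Longrightarrow>
    derives L (Suc n) (ctx_shift \<Gamma>) (insert \<phi> (weaken_obj ` \<Delta>)) (weaken_obj \<chi>) \<Longrightarrow>
    derives L n \<Gamma> \<Delta> \<chi>"
| AllAI: "wf_obj L n X \<Longrightarrow> wf_obj L n Y \<Longrightarrow>
    derives L n ((X, Y) # \<Gamma>) (weaken_arr ` \<Delta>) \<phi> \<Longrightarrow> derives L n \<Gamma> \<Delta> (AllA X Y \<phi>)"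
| AllAE: "derives L n \<Gamma> \<Delta> (AllA X Y \<phi>) \<Longrightarrow> has_sort L n \<Gamma> t X Y \<Longrightarrow>
    derives L n \<Gamma> \<Delta> (inst_arr t \<phi>)"
| ExAI: "wf_fm L n \<Gamma> (ExA X Y \<phi>) \<Longrightarrow> has_sort L n \<Gamma> t X Y \<Longrightarrow>
    derives L n \<Gamma> \<Delta> (inst_arr t \<phi>) \<Longrightarrow> derives L n \<Gamma> \<Delta> (ExA X Y \<phi>)"
| ExAE: "derives L n \<Gamma> \<Delta> (ExA X Y \<phi>) \<Longrightarrow> wf_fm L n \<Gamma> \<chi> \<Longrightarrow>
    derives L n ((X, Y) # \<Gamma>) (insert \<phi> (weaken_arr ` \<Delta>)) (weaken_arr \<chi>) \<Longrightarrow>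
    derives L n \<Gamma> \<Delta> \<chi>"

definition derivable_from ::
  "('o, 'a, 'x) cat_sig_scheme \<Rightarrow> ('o, 'a) fm set \<Rightarrow> ('o, 'a) fm \<Rightarrow> bool" where
  "derivable_from L \<Delta> \<phi> \<longleftrightarrow> derives L 0 [] \<Delta> \<phi>"

definition is_theory :: "('o, 'a) cat_theory \<Rightarrow> bool" where
  "is_theory T \<longleftrightarrow>
     (\<forall>c\<in>arr_consts T. src T c \<in> obj_consts T \<and> tgt T c \<in> obj_consts T) \<and>
     (\<forall>\<phi>\<in>axioms T. sentence T \<phi>)"

definition proves :: "('o, 'a) cat_theory \<Rightarrow> ('o, 'a) fm \<Rightarrow> bool"  (infix \<open>\<turnstile>\<close> 50) where
  "T \<turnstile> \<phi> \<longleftrightarrow> derivable_from T (axioms T) \<phi>"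


definition is_model :: "('o, 'a) cat_theory \<Rightarrow> ('o, 'a) fm set \<Rightarrow> bool" where
  "is_model T M \<longleftrightarrow>
     (\<forall>\<phi>\<in>M. \<exists>f g X Y. \<phi> = (f \<doteq> g) \<and> closed_arr T f X Y \<and> closed_arr T g X Y) \<and>
     (\<forall>\<phi>\<in>M. T \<turnstile> \<phi>) \<and>
     (\<forall>A\<in>obj_consts T. \<forall>B\<in>obj_consts T.
        equiv {f. closed_arr T f (OCon A) (OCon B)}
          {(f, g). closed_arr T f (OCon A) (OCon B) \<and> closed_arr T g (OCon A) (OCon B) \<and>
                   (f \<doteq> g) \<in> M}) \<and>
     (\<forall>X Y Z f\<^sub>1 f\<^sub>2 g\<^sub>1 g\<^sub>2.
        closed_arr T f\<^sub>1 X Y \<and> closed_arr T f\<^sub>2 X Y \<and>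
        closed_arr T g\<^sub>1 Y Z \<and> closed_arr T g\<^sub>2 Y Z \<and>
        (f\<^sub>1 \<doteq> f\<^sub>2) \<in> M \<and> (g\<^sub>1 \<doteq> g\<^sub>2) \<in> M \<longrightarrow> (g\<^sub>1 \<cdot> f\<^sub>1 \<doteq> g\<^sub>2 \<cdot> f\<^sub>2) \<in> M)"

primrec fm_size :: "('o, 'a) fm \<Rightarrow> nat" where
  "fm_size (f \<doteq> g) = 0"
| "fm_size Top = 0"
| "fm_size Bot = 0"
| "fm_size (And \<phi> \<psi>) = Suc (fm_size \<phi> + fm_size \<psi>)"
| "fm_size (Or \<phi> \<psi>) = Suc (fm_size \<phi> + fm_size \<psi>)"
| "fm_size (Imp \<phi> \<psi>) = Suc (fm_size \<phi> + fm_size \<psi>)"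
| "fm_size (AllO \<phi>) = Suc (fm_size \<phi>)"
| "fm_size (ExO \<phi>) = Suc (fm_size \<phi>)"
| "fm_size (AllA X Y \<phi>) = Suc (fm_size \<phi>)"
| "fm_size (ExA X Y \<phi>) = Suc (fm_size \<phi>)"

lemma fm_size_fsubst [simp]: "fm_size (fsubst \<sigma> \<tau> \<phi>) = fm_size \<phi>"
  by (induction \<phi> arbitrary: \<sigma> \<tau>) auto

lemma fm_size_inst [simp]:
  "fm_size (inst_obj X \<phi>) = fm_size \<phi>" "fm_size (inst_arr t \<phi>) = fm_size \<phi>"
  by (simp_all add: inst_obj_def inst_arr_def)

function FP :: "('o, 'a) cat_theory \<Rightarrow> ('o, 'a) fm set \<Rightarrow> ('o, 'a) fm \<Rightarrow> bool" where
  "FP T M (f \<doteq> g) \<longleftrightarrow> (f \<doteq> g) \<in> M"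
| "FP T M Top \<longleftrightarrow> True"
| "FP T M Bot \<longleftrightarrow> False"
| "FP T M (And \<phi> \<psi>) \<longleftrightarrow> FP T M \<phi> \<and> FP T M \<psi>"
| "FP T M (Or \<phi> \<psi>) \<longleftrightarrow> FP T M \<phi> \<or> FP T M \<psi>"
| "FP T M (Imp \<phi> \<psi>) \<longleftrightarrow> (FP T M \<phi> \<longrightarrow> FP T M \<psi>) \<and> T \<turnstile> Imp \<phi> \<psi>"
| "FP T M (ExO \<phi>) \<longleftrightarrow> (\<exists>X. closed_obj T X \<and> FP T M (inst_obj X \<phi>))"
| "FP T M (AllO \<phi>) \<longleftrightarrow> (\<forall>X. closed_obj T X \<longrightarrow> FP T M (inst_obj X \<phi>)) \<and> T \<turnstile> AllO \<phi>"
| "FP T M (ExA X Y \<phi>) \<longleftrightarrow> (\<exists>t. closed_arr T t X Y \<and> FP T M (inst_arr t \<phi>))"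
| "FP T M (AllA X Y \<phi>) \<longleftrightarrow>
     (\<forall>t. closed_arr T t X Y \<longrightarrow> FP T M (inst_arr t \<phi>)) \<and> T \<turnstile> AllA X Y \<phi>"
  by pat_completeness auto
termination
  by (relation "measure (\<lambda>(T, M, \<phi>). fm_size \<phi>)") auto

end

theory Submission
  imports Defs
begin

text \<open>
  \<^verbatim>\<open>FP\<close> is a realizability predicate (in the style of the Friedman slash): every sentence satisfying
  it is a theorem of \<open>T\<close>. Closure under deduction is soundness of natural deduction for \<^verbatim>\<open>FP\<close>, proved
  by induction on derivations in context, generalized over all substitutions of closed terms for the
  context variables. The provability clauses in \<^verbatim>\<open>FP\<close> of an implication or a universal
  quantification hold because derivability is closed under substitution and cut.
\<close>

section \<open>Simultaneous substitution\<close>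

text \<open>These are the maps by which \<open>fsubst\<close> crosses a binder. Arrow terms contain
  object variables through \<open>Ident\<close>, so an object binder also shifts
  \<open>\<tau>\<close>; object terms contain no arrow variables, so an arrow binder leaves
  \<open>\<sigma>\<close> alone.\<close>

abbreviation lift_obj :: "(nat \<Rightarrow> 'o obj) \<Rightarrow> nat \<Rightarrow> 'o obj" where
  "lift_obj \<sigma> \<equiv> case_nat (OVar 0) (\<lambda>i. oshift (\<sigma> i))"

abbreviation ashift_obj :: "('o, 'a) arr \<Rightarrow> ('o, 'a) arr" where
  "ashift_obj \<equiv> asubst (\<lambda>j. OVar (Suc j)) AVar"

abbreviation ashift_arr :: "('o, 'a) arr \<Rightarrow> ('o, 'a) arr" where
  "ashift_arr \<equiv> asubst OVar (\<lambda>j. AVar (Suc j))"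

abbreviation lift_arr :: "(nat \<Rightarrow> ('o, 'a) arr) \<Rightarrow> nat \<Rightarrow> ('o, 'a) arr" where
  "lift_arr \<tau> \<equiv> case_nat (AVar 0) (\<lambda>i. ashift_arr (\<tau> i))"

lemma osubst_osubst: "osubst \<sigma>' (osubst \<sigma> X) = osubst (\<lambda>i. osubst \<sigma>' (\<sigma> i)) X"
  by (cases X) auto

lemma asubst_asubst:
  "asubst \<sigma>' \<tau>' (asubst \<sigma> \<tau> t) = asubst (\<lambda>i. osubst \<sigma>' (\<sigma> i)) (\<lambda>i. asubst \<sigma>' \<tau>' (\<tau> i)) t"
  by (induction t) (auto simp: osubst_osubst)

lemma osubst_OVar [simp]: "osubst OVar X = X"
  by (cases X) auto

lemma asubst_Var [simp]: "asubst OVar AVar t = t"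
  by (induction t) auto

lemma case_nat_Var [simp]:
  "case_nat (OVar 0) (\<lambda>i. OVar (Suc i)) = OVar"
  "case_nat (AVar 0) (\<lambda>i. AVar (Suc i)) = AVar"
  by (auto simp: fun_eq_iff split: nat.split)

lemma fsubst_Var [simp]: "fsubst OVar AVar \<phi> = \<phi>"
  by (induction \<phi>) auto

text \<open>Serves the object binder cases of \<open>fsubst_fsubst\<close>. For the arrow part
  there, \<open>asubst_asubst\<close> alone brings both sides to a common form.\<close>

lemma osubst_lift_obj_lift_obj:
  "(\<lambda>i. osubst (lift_obj \<sigma>') (lift_obj \<sigma> i)) = lift_obj (\<lambda>i. osubst \<sigma>' (\<sigma> i))"
  by (auto simp: fun_eq_iff osubst_osubst split: nat.split)

lemma asubst_lift_arr_lift_arr: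
  "(\<lambda>i. asubst \<sigma>' (lift_arr \<tau>') (lift_arr \<tau> i)) = lift_arr (\<lambda>i. asubst \<sigma>' \<tau>' (\<tau> i))"
  by (auto simp: fun_eq_iff asubst_asubst split: nat.split)

lemma fsubst_fsubst:
  "fsubst \<sigma>' \<tau>' (fsubst \<sigma> \<tau> \<phi>) = fsubst (\<lambda>i. osubst \<sigma>' (\<sigma> i)) (\<lambda>i. asubst \<sigma>' \<tau>' (\<tau> i)) \<phi>"
  by (induction \<phi> arbitrary: \<sigma> \<tau> \<sigma>' \<tau>')
    (simp_all add: osubst_osubst asubst_asubst
      osubst_lift_obj_lift_obj asubst_lift_arr_lift_arr)

text \<open>Instantiation undoes the shift made at the binder. This turns the quantifier clauses of
  \<open>FP\<close> and the quantifier rules into statements about a substitution extended by one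
  term.\<close>

lemma inst_obj_lift:
  "inst_obj X (fsubst (lift_obj \<sigma>) (\<lambda>i. ashift_obj (\<tau> i)) \<phi>) = fsubst (case_nat X \<sigma>) \<tau> \<phi>"
  by (auto simp: inst_obj_def fsubst_fsubst osubst_osubst asubst_asubst
      intro!: arg_cong2[where f = "\<lambda>\<sigma> \<tau>. fsubst \<sigma> \<tau> \<phi>"] split: nat.split)

lemma inst_arr_lift:
  "inst_arr t (fsubst \<sigma> (lift_arr \<tau>) \<phi>) = fsubst \<sigma> (case_nat t \<tau>) \<phi>"
  by (auto simp: inst_arr_def fsubst_fsubst osubst_osubst asubst_asubst
      intro!: arg_cong2[where f = "\<lambda>\<sigma> \<tau>. fsubst \<sigma> \<tau> \<phi>"] split: nat.split)

text \<open>The normal form is that of \<open>inst_obj_lift\<close>; together they make substitution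
  commute with instantiation.\<close>

lemma fsubst_inst_obj:
  "fsubst \<sigma> \<tau> (inst_obj X \<phi>) = fsubst (case_nat (osubst \<sigma> X) \<sigma>) \<tau> \<phi>"
  by (auto simp: inst_obj_def fsubst_fsubst
      intro!: arg_cong2[where f = "\<lambda>\<sigma> \<tau>. fsubst \<sigma> \<tau> \<phi>"] split: nat.split)

lemma fsubst_inst_arr:
  "fsubst \<sigma> \<tau> (inst_arr t \<phi>) = fsubst \<sigma> (case_nat (asubst \<sigma> \<tau> t) \<tau>) \<phi>"
  by (auto simp: inst_arr_def fsubst_fsubst
      intro!: arg_cong2[where f = "\<lambda>\<sigma> \<tau>. fsubst \<sigma> \<tau> \<phi>"] split: nat.split)

text \<open>A weakened formula does not mention index 0, so the value given there is irrelevant: the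
  eigenvariable condition in de Bruijn form.\<close>

lemma fsubst_weaken_obj [simp]: "fsubst (case_nat X \<sigma>) \<tau> (weaken_obj \<phi>) = fsubst \<sigma> \<tau> \<phi>"
  by (simp add: weaken_obj_def fsubst_fsubst)

lemma fsubst_weaken_arr [simp]: "fsubst \<sigma> (case_nat t \<tau>) (weaken_arr \<phi>) = fsubst \<sigma> \<tau> \<phi>"
  by (simp add: weaken_arr_def fsubst_fsubst)

lemma weaken_obj_fsubst:
  "weaken_obj (fsubst \<sigma> \<tau> \<phi>) = fsubst (\<lambda>i. oshift (\<sigma> i)) (\<lambda>i. ashift_obj (\<tau> i)) \<phi>"
  by (simp add: weaken_obj_def fsubst_fsubst)

lemma weaken_arr_fsubst:
  "weaken_arr (fsubst \<sigma> \<tau> \<phi>) = fsubst \<sigma> (\<lambda>i. ashift_arr (\<tau> i)) \<phi>"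
  by (simp add: weaken_arr_def fsubst_fsubst)

section \<open>Sort-preserving substitutions\<close>

text \<open>A morphism of contexts, sending the variables of \<open>n\<close>,
  \<open>\<Gamma>\<close> to terms over \<open>n'\<close>, \<open>\<Gamma>'\<close>. Sorts of arrow
  variables mention object variables, so the expected endpoints are substituted too. Closed
  substitutions are those into \<open>0\<close>, \<open>[]\<close>.\<close>

definition sorted_subst where
  "sorted_subst L n \<Gamma> n' \<Gamma>' \<sigma> \<tau> \<longleftrightarrow>
     (\<forall>i<n. wf_obj L n' (\<sigma> i)) \<and>
     (\<forall>i<length \<Gamma>. has_sort L n' \<Gamma>' (\<tau> i) (osubst \<sigma> (fst (\<Gamma> ! i))) (osubst \<sigma> (snd (\<Gamma> ! i))))"

lemma wf_obj_osubst:
  "wf_obj L n X \<Longrightarrow> sorted_subst L n \<Gamma> n' \<Gamma>' \<sigma> \<tau> \<Longrightarrow> wf_obj L n' (osubst \<sigma> X)"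
  by (cases X) (auto simp: sorted_subst_def)

lemma has_sort_asubst:
  assumes "has_sort L n \<Gamma> t X Y" "sorted_subst L n \<Gamma> n' \<Gamma>' \<sigma> \<tau>"
  shows "has_sort L n' \<Gamma>' (asubst \<sigma> \<tau> t) (osubst \<sigma> X) (osubst \<sigma> Y)"
  using assms
proof (induction rule: has_sort.induct)
  case (sort_var i X Y)
  then show ?case by (auto simp: sorted_subst_def)
qed (auto intro: has_sort.intros wf_obj_osubst)

lemma sorted_subst_comp:
  assumes "sorted_subst L n \<Gamma> n' \<Gamma>' \<sigma> \<tau>" "sorted_subst L n' \<Gamma>' n'' \<Gamma>'' \<sigma>' \<tau>'"
  shows "sorted_subst L n \<Gamma> n'' \<Gamma>'' (\<lambda>i. osubst \<sigma>' (\<sigma> i)) (\<lambda>i. asubst \<sigma>' \<tau>' (\<tau> i))"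
  unfolding sorted_subst_def
proof (intro conjI allI impI)
  fix i assume "i < n"
  then show "wf_obj L n'' (osubst \<sigma>' (\<sigma> i))"
    using assms wf_obj_osubst by (fastforce simp: sorted_subst_def[of L n \<Gamma>])
next
  fix i assume "i < length \<Gamma>"
  then show "has_sort L n'' \<Gamma>'' (asubst \<sigma>' \<tau>' (\<tau> i))
      (osubst (\<lambda>i. osubst \<sigma>' (\<sigma> i)) (fst (\<Gamma> ! i))) (osubst (\<lambda>i. osubst \<sigma>' (\<sigma> i)) (snd (\<Gamma> ! i)))"
    using has_sort_asubst[OF _ assms(2)] assms(1)
    by (auto simp: sorted_subst_def[of L n \<Gamma>] simp flip: osubst_osubst)
qed

lemma sorted_subst_Var: "sorted_subst L n \<Gamma> n \<Gamma> OVar AVar"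
  by (auto simp: sorted_subst_def intro: sort_var)

lemma sorted_subst_shift_obj:
  "sorted_subst L n \<Gamma> (Suc n) (ctx_shift \<Gamma>) (\<lambda>i. OVar (Suc i)) AVar"
  by (auto simp: sorted_subst_def ctx_shift_def intro!: sort_var prod_eqI)

lemma sorted_subst_shift_arr:
  "sorted_subst L n \<Gamma> n ((X, Y) # \<Gamma>) OVar (\<lambda>i. AVar (Suc i))"
  by (auto simp: sorted_subst_def intro!: sort_var)

lemma sorted_subst_case_obj:
  assumes "sorted_subst L n \<Gamma> n' \<Gamma>' \<sigma> \<tau>" "wf_obj L n' X"
  shows "sorted_subst L (Suc n) (ctx_shift \<Gamma>) n' \<Gamma>' (case_nat X \<sigma>) \<tau>"
  using assms by (auto simp: sorted_subst_def ctx_shift_def osubst_osubst split: nat.split)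

lemma sorted_subst_case_arr:
  assumes "sorted_subst L n \<Gamma> n' \<Gamma>' \<sigma> \<tau>" "has_sort L n' \<Gamma>' t (osubst \<sigma> X) (osubst \<sigma> Y)"
  shows "sorted_subst L n ((X, Y) # \<Gamma>) n' \<Gamma>' \<sigma> (case_nat t \<tau>)"
  using assms by (auto simp: sorted_subst_def split: nat.split)

text \<open>A lift is the composite with the shift, extended by the new variable as its own
  image.\<close>

lemma sorted_subst_lift_obj:
  assumes "sorted_subst L n \<Gamma> n' \<Gamma>' \<sigma> \<tau>"
  shows "sorted_subst L (Suc n) (ctx_shift \<Gamma>) (Suc n') (ctx_shift \<Gamma>')
    (lift_obj \<sigma>) (\<lambda>i. ashift_obj (\<tau> i))"
  by (rule sorted_subst_case_obj[OF sorted_subst_comp[OF assms sorted_subst_shift_obj]]) simp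

lemma sorted_subst_lift_arr:
  assumes "sorted_subst L n \<Gamma> n' \<Gamma>' \<sigma> \<tau>"
  shows "sorted_subst L n ((X, Y) # \<Gamma>) n' ((osubst \<sigma> X, osubst \<sigma> Y) # \<Gamma>') \<sigma> (lift_arr \<tau>)"
  using sorted_subst_comp[OF assms sorted_subst_shift_arr]
  by (auto intro!: sorted_subst_case_arr sort_var)

lemma wf_fm_fsubst:
  "wf_fm L n \<Gamma> \<phi> \<Longrightarrow> sorted_subst L n \<Gamma> n' \<Gamma>' \<sigma> \<tau> \<Longrightarrow> wf_fm L n' \<Gamma>' (fsubst \<sigma> \<tau> \<phi>)"
proof (induction \<phi> arbitrary: n \<Gamma> n' \<Gamma>' \<sigma> \<tau>)
  case (Eq f g)
  then show ?case using has_sort_asubst by fastforce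
next
  case (AllO \<phi>)
  then show ?case by (auto intro: AllO.IH sorted_subst_lift_obj)
next
  case (ExO \<phi>)
  then show ?case by (auto intro: ExO.IH sorted_subst_lift_obj)
next
  case (AllA X Y \<phi>)
  then show ?case by (auto intro: AllA.IH sorted_subst_lift_arr wf_obj_osubst)
next
  case (ExA X Y \<phi>)
  then show ?case by (auto intro: ExA.IH sorted_subst_lift_arr wf_obj_osubst)
qed auto

lemma wf_fm_inst_obj:
  "wf_fm L (Suc n) (ctx_shift \<Gamma>) \<phi> \<Longrightarrow> wf_obj L n X \<Longrightarrow> wf_fm L n \<Gamma> (inst_obj X \<phi>)"
  unfolding inst_obj_def by (blast intro: wf_fm_fsubst sorted_subst_case_obj sorted_subst_Var)

lemma wf_fm_inst_arr:
  "wf_fm L n ((X, Y) # \<Gamma>) \<phi> \<Longrightarrow> has_sort L n \<Gamma> t X Y \<Longrightarrow> wf_fm L n \<Gamma> (inst_arr t \<phi>)"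
  unfolding inst_arr_def by (auto intro!: wf_fm_fsubst sorted_subst_case_arr sorted_subst_Var)

lemma wf_fm_weaken_obj: "wf_fm L n \<Gamma> \<phi> \<Longrightarrow> wf_fm L (Suc n) (ctx_shift \<Gamma>) (weaken_obj \<phi>)"
  unfolding weaken_obj_def by (blast intro: wf_fm_fsubst sorted_subst_shift_obj)

lemma wf_fm_weaken_arr: "wf_fm L n \<Gamma> \<phi> \<Longrightarrow> wf_fm L n ((X, Y) # \<Gamma>) (weaken_arr \<phi>)"
  unfolding weaken_arr_def by (blast intro: wf_fm_fsubst sorted_subst_shift_arr)

section \<open>Derivability\<close>

lemma wf_equality_axiom: "\<phi> \<in> equality_axioms \<Longrightarrow> wf_fm L n \<Gamma> \<phi>"
  unfolding equality_axioms_def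
  by (auto simp: ctx_shift_def numeral_eq_Suc intro!: exI sort_comp sort_var)

text \<open>The axioms are closed; writing the indices with \<open>Suc\<close> lets the lifted
  substitutions be evaluated at them.\<close>

lemma fsubst_equality_axiom: "\<phi> \<in> equality_axioms \<Longrightarrow> fsubst \<sigma> \<tau> \<phi> = \<phi>"
  unfolding equality_axioms_def by (auto simp: numeral_eq_Suc)

text \<open>\<open>Hyp\<close> checks the hypothesis it uses, and the other rules carry side
  conditions for formulas that their premises do not already check.\<close>

lemma derives_wf: "derives L n \<Gamma> \<Delta> \<phi> \<Longrightarrow> wf_fm L n \<Gamma> \<phi>"
  by (induction rule: derives.induct)
    (auto simp: wf_equality_axiom wf_fm_inst_obj wf_fm_inst_arr)

text \<open>Induction on the derivation, lifting the substitution at each binder. Allowing any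
  \<open>\<Delta>'\<close> above the image of \<open>\<Delta>\<close> builds monotonicity into the
  same induction.\<close>

lemma derives_fsubst:
  assumes "derives L n \<Gamma> \<Delta> \<phi>" "sorted_subst L n \<Gamma> n' \<Gamma>' \<sigma> \<tau>" "fsubst \<sigma> \<tau> ` \<Delta> \<subseteq> \<Delta>'"
  shows "derives L n' \<Gamma>' \<Delta>' (fsubst \<sigma> \<tau> \<phi>)"
  using assms
proof (induction arbitrary: n' \<Gamma>' \<sigma> \<tau> \<Delta>' rule: derives.induct)
  case (Hyp \<phi> \<Delta> n \<Gamma>)
  then show ?case by (auto intro!: derives.Hyp wf_fm_fsubst)
next
  case (EqAx \<phi> n \<Gamma> \<Delta>)
  then show ?case by (simp add: fsubst_equality_axiom derives.EqAx)
next
  case (TopI n \<Gamma> \<Delta>)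
  then show ?case by (simp add: derives.TopI)
next
  case (BotE n \<Gamma> \<Delta> \<phi>)
  from derives.BotE[OF BotE.IH[OF BotE.prems, simplified]
      wf_fm_fsubst[OF BotE.hyps(2) BotE.prems(1)]]
  show ?case .
next
  case (AndI n \<Gamma> \<Delta> \<phi> \<psi>)
  then show ?case by (auto intro!: derives.AndI)
next
  case (AndE1 n \<Gamma> \<Delta> \<phi> \<psi>)
  \<comment> \<open>The eliminated formula does not occur in the goal, so the rule is composed
    forward from the induction hypothesis.\<close>
  from derives.AndE1[OF AndE1.IH[OF AndE1.prems, simplified]] show ?case .
next
  case (AndE2 n \<Gamma> \<Delta> \<phi> \<psi>)
  from derives.AndE2[OF AndE2.IH[OF AndE2.prems, simplified]] show ?case .
next
  case (OrI1 n \<Gamma> \<Delta> \<phi> \<psi>)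
  then show ?case by (auto intro!: derives.OrI1 wf_fm_fsubst)
next
  case (OrI2 n \<Gamma> \<Delta> \<psi> \<phi>)
  then show ?case by (auto intro!: derives.OrI2 wf_fm_fsubst)
next
  case (OrE n \<Gamma> \<Delta> \<phi> \<psi> \<chi>)
  have "derives L n' \<Gamma>' \<Delta>' (Or (fsubst \<sigma> \<tau> \<phi>) (fsubst \<sigma> \<tau> \<psi>))"
    using OrE.IH(1)[OF OrE.prems] by simp
  moreover have "derives L n' \<Gamma>' (insert (fsubst \<sigma> \<tau> \<phi>) \<Delta>') (fsubst \<sigma> \<tau> \<chi>)"
    using OrE.prems by (intro OrE.IH(2)) auto
  moreover have "derives L n' \<Gamma>' (insert (fsubst \<sigma> \<tau> \<psi>) \<Delta>') (fsubst \<sigma> \<tau> \<chi>)"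
    using OrE.prems by (intro OrE.IH(3)) auto
  ultimately show ?case by (rule derives.OrE)
next
  case (ImpI n \<Gamma> \<phi> \<Delta> \<psi>)
  have "derives L n' \<Gamma>' (insert (fsubst \<sigma> \<tau> \<phi>) \<Delta>') (fsubst \<sigma> \<tau> \<psi>)"
    using ImpI.prems by (intro ImpI.IH) auto
  then show ?case using ImpI by (auto intro!: derives.ImpI wf_fm_fsubst)
next
  case (ImpE n \<Gamma> \<Delta> \<phi> \<psi>)
  from derives.ImpE[OF ImpE.IH(1)[OF ImpE.prems, simplified] ImpE.IH(2)[OF ImpE.prems]]
  show ?case .
next
  case (AllOI n \<Gamma> \<Delta> \<phi>)
  \<comment> \<open>Substituting under the lift into a weakened hypothesis gives the weakening of
    the substituted one, so the hypotheses stay within \<open>weaken_obj\<close> applied to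
    \<open>\<Delta>'\<close>.\<close>
  have "derives L (Suc n') (ctx_shift \<Gamma>') (weaken_obj ` \<Delta>')
      (fsubst (lift_obj \<sigma>) (\<lambda>i. ashift_obj (\<tau> i)) \<phi>)"
    using AllOI.prems
    by (intro AllOI.IH sorted_subst_lift_obj) (auto simp flip: weaken_obj_fsubst)
  then show ?case by (auto intro: derives.AllOI)
next
  case (AllOE n \<Gamma> \<Delta> \<phi> X)
  from derives.AllOE[OF AllOE.IH[OF AllOE.prems, simplified]
      wf_obj_osubst[OF AllOE.hyps(2) AllOE.prems(1)]]
  show ?case by (simp add: inst_obj_lift fsubst_inst_obj)
next
  case (ExOI n \<Gamma> \<phi> X \<Delta>)
  have "wf_fm L n' \<Gamma>' (fsubst \<sigma> \<tau> (ExO \<phi>))"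
    using ExOI by (blast intro: wf_fm_fsubst)
  then show ?case
    using ExOI.IH[OF ExOI.prems] wf_obj_osubst[OF ExOI.hyps(2) ExOI.prems(1)]
    by (auto simp: inst_obj_lift fsubst_inst_obj simp del: wf_fm.simps
        intro!: derives.ExOI[where X = "osubst \<sigma> X"])
next
  case (ExOE n \<Gamma> \<Delta> \<phi> \<chi>)
  let ?l = "fsubst (lift_obj \<sigma>) (\<lambda>i. ashift_obj (\<tau> i))"
  have "derives L (Suc n') (ctx_shift \<Gamma>') (insert (?l \<phi>) (weaken_obj ` \<Delta>')) (?l (weaken_obj \<chi>))"
    using ExOE.prems
    by (intro ExOE.IH(2) sorted_subst_lift_obj) (auto simp flip: weaken_obj_fsubst)
  \<comment> \<open>The lifted substitution of \<open>weaken_obj \<chi>\<close> is rewritten as the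
    weakening of the substituted \<open>\<chi>\<close>, the shape that \<open>ExOE\<close>
    expects.\<close>
  from derives.ExOE[OF ExOE.IH(1)[OF ExOE.prems, simplified]
      wf_fm_fsubst[OF ExOE.hyps(2) ExOE.prems(1)]
      this[unfolded fsubst_weaken_obj, folded weaken_obj_fsubst]]
  show ?case .
next
  case (AllAI n X Y \<Gamma> \<Delta> \<phi>)
  have "derives L n' ((osubst \<sigma> X, osubst \<sigma> Y) # \<Gamma>') (weaken_arr ` \<Delta>')
      (fsubst \<sigma> (lift_arr \<tau>) \<phi>)"
    using AllAI.prems
    by (intro AllAI.IH sorted_subst_lift_arr) (auto simp flip: weaken_arr_fsubst)
  then show ?case using AllAI by (auto intro: derives.AllAI wf_obj_osubst)
next
  case (AllAE n \<Gamma> \<Delta> X Y \<phi> t)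
  from derives.AllAE[OF AllAE.IH[OF AllAE.prems, simplified]
      has_sort_asubst[OF AllAE.hyps(2) AllAE.prems(1)]]
  show ?case by (simp add: inst_arr_lift fsubst_inst_arr)
next
  case (ExAI n \<Gamma> X Y \<phi> t \<Delta>)
  have "wf_fm L n' \<Gamma>' (fsubst \<sigma> \<tau> (ExA X Y \<phi>))"
    using ExAI by (blast intro: wf_fm_fsubst)
  then show ?case
    using ExAI.IH[OF ExAI.prems] has_sort_asubst[OF ExAI.hyps(2) ExAI.prems(1)]
    by (auto simp: inst_arr_lift fsubst_inst_arr simp del: wf_fm.simps
        intro!: derives.ExAI[where t = "asubst \<sigma> \<tau> t"])
next
  case (ExAE n \<Gamma> \<Delta> X Y \<phi> \<chi>)
  let ?l = "fsubst \<sigma> (lift_arr \<tau>)"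
  have "derives L n' ((osubst \<sigma> X, osubst \<sigma> Y) # \<Gamma>')
      (insert (?l \<phi>) (weaken_arr ` \<Delta>')) (?l (weaken_arr \<chi>))"
    using ExAE.prems
    by (intro ExAE.IH(2) sorted_subst_lift_arr) (auto simp flip: weaken_arr_fsubst)
  from derives.ExAE[OF ExAE.IH(1)[OF ExAE.prems, simplified]
      wf_fm_fsubst[OF ExAE.hyps(2) ExAE.prems(1)]
      this[unfolded fsubst_weaken_arr, folded weaken_arr_fsubst]]
  show ?case .
qed

section \<open>Structural rules: monotonicity, weakening and cut\<close>

lemma derives_mono: "derives L n \<Gamma> \<Delta> \<phi> \<Longrightarrow> \<Delta> \<subseteq> \<Delta>' \<Longrightarrow> derives L n \<Gamma> \<Delta>' \<phi>"
  using derives_fsubst[OF _ sorted_subst_Var] by fastforce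

lemma derives_weaken_obj:
  "derives L n \<Gamma> \<Delta> \<phi> \<Longrightarrow> derives L (Suc n) (ctx_shift \<Gamma>) (weaken_obj ` \<Delta>) (weaken_obj \<phi>)"
  unfolding weaken_obj_def by (blast intro: derives_fsubst sorted_subst_shift_obj)

lemma derives_weaken_arr:
  "derives L n \<Gamma> \<Delta> \<phi> \<Longrightarrow> derives L n ((X, Y) # \<Gamma>) (weaken_arr ` \<Delta>) (weaken_arr \<phi>)"
  unfolding weaken_arr_def by (blast intro: derives_fsubst sorted_subst_shift_arr)

text \<open>Carries the cut assumption through rules that discharge a hypothesis;
  \<open>\<phi>\<close> itself is derived by \<open>Hyp\<close>, which requires it to be
  well-formed.\<close>

lemma derives_insert_hyps:
  assumes "\<forall>\<delta>\<in>\<Delta>. derives L n \<Gamma> \<Delta>' \<delta>" "wf_fm L n \<Gamma> \<phi>"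
  shows "\<forall>\<delta>\<in>insert \<phi> \<Delta>. derives L n \<Gamma> (insert \<phi> \<Delta>') \<delta>"
  using assms by (auto intro: derives_mono derives.Hyp)

text \<open>Each use of \<open>Hyp\<close> is replaced by the given derivation, which is weakened
  whenever a binder is crossed. Induction is used rather than discharging into implications because
  \<open>\<Delta>\<close> may be infinite.\<close>

lemma derives_cut:
  assumes "derives L n \<Gamma> \<Delta> \<phi>" "\<forall>\<delta>\<in>\<Delta>. derives L n \<Gamma> \<Delta>' \<delta>"
  shows "derives L n \<Gamma> \<Delta>' \<phi>"
  using assms
proof (induction arbitrary: \<Delta>' rule: derives.induct)
  case (Hyp \<phi> \<Delta> n \<Gamma>)
  then show ?case by simp
next
  case (OrE n \<Gamma> \<Delta> \<phi> \<psi> \<chi>)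
  have wf: "wf_fm L n \<Gamma> \<phi>" "wf_fm L n \<Gamma> \<psi>"
    using derives_wf[OF OrE.hyps(1)] by simp_all
  show ?case
    by (rule derives.OrE[OF OrE.IH(1)[OF OrE.prems]
          OrE.IH(2)[OF derives_insert_hyps[OF OrE.prems wf(1)]]
          OrE.IH(3)[OF derives_insert_hyps[OF OrE.prems wf(2)]]])
next
  case (ImpI n \<Gamma> \<phi> \<Delta> \<psi>)
  show ?case
    by (rule derives.ImpI[OF ImpI.hyps(1)
          ImpI.IH[OF derives_insert_hyps[OF ImpI.prems ImpI.hyps(1)]]])
next
  case (AllOI n \<Gamma> \<Delta> \<phi>)
  then show ?case by (auto intro!: derives.AllOI AllOI.IH derives_weaken_obj)
next
  case (ExOE n \<Gamma> \<Delta> \<phi> \<chi>)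
  have "wf_fm L (Suc n) (ctx_shift \<Gamma>) \<phi>"
    using derives_wf[OF ExOE.hyps(1)] by simp
  then have "\<forall>\<delta>\<in>insert \<phi> (weaken_obj ` \<Delta>).
      derives L (Suc n) (ctx_shift \<Gamma>) (insert \<phi> (weaken_obj ` \<Delta>')) \<delta>"
    using ExOE.prems by (intro derives_insert_hyps) (auto intro: derives_weaken_obj)
  from derives.ExOE[OF ExOE.IH(1)[OF ExOE.prems] ExOE.hyps(2) ExOE.IH(2)[OF this]]
  show ?case .
next
  case (AllAI n X Y \<Gamma> \<Delta> \<phi>)
  then show ?case by (auto intro!: derives.AllAI AllAI.IH derives_weaken_arr)
next
  case (ExAE n \<Gamma> \<Delta> X Y \<phi> \<chi>)
  have "wf_fm L n ((X, Y) # \<Gamma>) \<phi>"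
    using derives_wf[OF ExAE.hyps(1)] by simp
  then have "\<forall>\<delta>\<in>insert \<phi> (weaken_arr ` \<Delta>).
      derives L n ((X, Y) # \<Gamma>) (insert \<phi> (weaken_arr ` \<Delta>')) \<delta>"
    using ExAE.prems by (intro derives_insert_hyps) (auto intro: derives_weaken_arr)
  from derives.ExAE[OF ExAE.IH(1)[OF ExAE.prems] ExAE.hyps(2) ExAE.IH(2)[OF this]]
  show ?case .
next
  case (AndE1 n \<Gamma> \<Delta> \<phi> \<psi>)
  show ?case by (rule derives.AndE1[OF AndE1.IH[OF AndE1.prems]])
next
  case (AndE2 n \<Gamma> \<Delta> \<phi> \<psi>)
  show ?case by (rule derives.AndE2[OF AndE2.IH[OF AndE2.prems]])
next
  case (ImpE n \<Gamma> \<Delta> \<phi> \<psi>)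
  show ?case by (rule derives.ImpE[OF ImpE.IH[OF ImpE.prems]])
next
  case (BotE n \<Gamma> \<Delta> \<phi>)
  show ?case by (rule derives.BotE[OF BotE.IH[OF BotE.prems] BotE.hyps(2)])
next
  case (AllAE n \<Gamma> \<Delta> X Y \<phi> t)
  show ?case by (rule derives.AllAE[OF AllAE.IH[OF AllAE.prems] AllAE.hyps(2)])
qed (simp_all add: derives.EqAx derives.TopI derives.AndI derives.OrI1 derives.OrI2
    derives.AllOE derives.ExOI derives.ExAI)

section \<open>Soundness of FP\<close>

text \<open>Existential clauses pass to an instance, which is not a subformula, so the induction is
  on \<open>fm_size\<close>, invariant under instantiation.\<close>

lemma FP_imp_proves:
  assumes "is_model T M"
  shows "sentence T \<phi> \<Longrightarrow> FP T M \<phi> \<Longrightarrow> T \<turnstile> \<phi>"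
proof (induction "fm_size \<phi>" arbitrary: \<phi> rule: less_induct)
  case less
  note IH = less.hyps
  show ?case
  proof (cases \<phi>)
    case (Eq f g)
    then show ?thesis using less.prems assms by (auto simp: is_model_def)
  next
    case Top
    then show ?thesis by (simp add: proves_def derivable_from_def derives.TopI)
  next
    case Bot
    then show ?thesis using less.prems by simp
  next
    case (And \<phi>1 \<phi>2)
    then show ?thesis
      using less.prems IH[of \<phi>1] IH[of \<phi>2]
      by (auto simp: proves_def derivable_from_def intro: derives.AndI)
  next
    case (Or \<phi>1 \<phi>2)
    then show ?thesis
      using less.prems IH[of \<phi>1] IH[of \<phi>2]
      by (auto simp: proves_def derivable_from_def intro: derives.OrI1 derives.OrI2)
  next
    case (ExO \<phi>1)
    then obtain X where X: "closed_obj T X" "FP T M (inst_obj X \<phi>1)"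
      using less.prems by auto
    then have "T \<turnstile> inst_obj X \<phi>1"
      using ExO less.prems by (intro IH wf_fm_inst_obj) auto
    then show ?thesis
      using ExO X less.prems by (auto simp: proves_def derivable_from_def intro: derives.ExOI)
  next
    case (ExA X Y \<phi>1)
    then obtain t where t: "closed_arr T t X Y" "FP T M (inst_arr t \<phi>1)"
      using less.prems by auto
    then have "T \<turnstile> inst_arr t \<phi>1"
      using ExA less.prems by (intro IH wf_fm_inst_arr) auto
    then show ?thesis
      using ExA t less.prems by (auto simp: proves_def derivable_from_def intro: derives.ExAI)
  \<comment> \<open>Implications and universal quantifications remain; their \<open>FP\<close>
    clauses contain provability.\<close>
  qed (use less.prems in simp_all)
qed

text \<open>Closed object terms are constants. Each instance comes with its own provability, so the
  rule can be applied repeatedly down a quantifier prefix.\<close>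

lemma FP_AllO_intro:
  assumes "T \<turnstile> AllO \<phi>"
    and "\<And>A. A \<in> obj_consts T \<Longrightarrow> T \<turnstile> inst_obj (OCon A) \<phi> \<Longrightarrow> FP T M (inst_obj (OCon A) \<phi>)"
  shows "FP T M (AllO \<phi>)"
proof -
  have "FP T M (inst_obj X \<phi>)" if "closed_obj T X" for X
    using that assms derives.AllOE[of T 0 "[]" "axioms T" \<phi> X]
    by (cases X) (auto simp: proves_def derivable_from_def)
  then show ?thesis using assms(1) by simp
qed

lemma FP_AllA_intro:
  assumes "T \<turnstile> AllA X Y \<phi>"
    and "\<And>t. closed_arr T t X Y \<Longrightarrow> T \<turnstile> inst_arr t \<phi> \<Longrightarrow> FP T M (inst_arr t \<phi>)"
  shows "FP T M (AllA X Y \<phi>)"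
  using assms derives.AllAE[of T 0 "[]" "axioms T" X Y \<phi>]
  by (auto simp: proves_def derivable_from_def)

text \<open>Keeps terms already inserted for outer quantifiers fixed while inner ones are
  instantiated.\<close>

lemma asubst_closed_arr: "closed_arr L t X Y \<Longrightarrow> asubst \<sigma> \<tau> t = t"
proof (induction rule: has_sort.induct)
  case (sort_ident X)
  then show ?case by (cases X) auto
qed auto

text \<open>Closed instances hold by the equivalence and composition clauses of
  \<open>is_model\<close>; the provability demanded at every quantifier and implication descends
  from \<open>EqAx\<close>.\<close>

lemma FP_equality_axiom:
  assumes M: "is_model T M" and ax: "\<phi> \<in> equality_axioms"
  shows "FP T M \<phi>"
proof -
  define R where "R A B = {(f, g). closed_arr T f (OCon A) (OCon B) \<and>
    closed_arr T g (OCon A) (OCon B) \<and> (f \<doteq> g) \<in> M}" for A B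
  have R: "equiv {f. closed_arr T f (OCon A) (OCon B)} (R A B)"
    if "A \<in> obj_consts T" "B \<in> obj_consts T" for A B
    using M that unfolding is_model_def R_def by simp
  have refl: "(f \<doteq> f) \<in> M"
    if "A \<in> obj_consts T" "B \<in> obj_consts T" "closed_arr T f (OCon A) (OCon B)" for A B f
    using equiv_class_self[OF R[OF that(1,2)], of f] that(3) by (simp add: R_def)
  have sym: "(g \<doteq> f) \<in> M"
    if "A \<in> obj_consts T" "B \<in> obj_consts T" "closed_arr T f (OCon A) (OCon B)"
      "closed_arr T g (OCon A) (OCon B)" "(f \<doteq> g) \<in> M" for A B f g
    using equivE[OF R[OF that(1,2)]] that(3-) symD[of "R A B" f g] by (auto simp: R_def)
  have trans: "(f \<doteq> h) \<in> M"
    if "A \<in> obj_consts T" "B \<in> obj_consts T" "closed_arr T f (OCon A) (OCon B)"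
      "closed_arr T g (OCon A) (OCon B)" "closed_arr T h (OCon A) (OCon B)"
      "(f \<doteq> g) \<in> M" "(g \<doteq> h) \<in> M" for A B f g h
    using equivE[OF R[OF that(1,2)]] that(3-) transD[of "R A B" f g h] by (auto simp: R_def)
  have comp: "(g1 \<cdot> f1 \<doteq> g2 \<cdot> f2) \<in> M"
    if "closed_arr T f1 X Y" "closed_arr T f2 X Y" "closed_arr T g1 Y Z" "closed_arr T g2 Y Z"
      "(f1 \<doteq> f2) \<in> M" "(g1 \<doteq> g2) \<in> M" for X Y Z f1 f2 g1 g2
    using M that unfolding is_model_def by blast
  have "\<forall>\<phi>\<in>equality_axioms. T \<turnstile> \<phi>"
    by (simp add: proves_def derivable_from_def derives.EqAx)
  then have "\<forall>\<phi>\<in>equality_axioms. FP T M \<phi>"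
    unfolding equality_axioms_def ball_simps
    \<comment> \<open>The four axioms are split, then quantifiers are peeled off one at a time.
      \<open>FP.simps\<close> is withheld so that the next quantifier stays in the form the
      introduction rules match.\<close>
    by - (elim conjE, intro conjI TrueI;
        (rule FP_AllO_intro FP_AllA_intro, assumption,
          simp add: inst_obj_def inst_arr_def numeral_eq_Suc asubst_closed_arr del: FP.simps)+,
        (auto intro: refl sym trans comp))
  then show ?thesis using ax by blast
qed

text \<open>Supplies the provability conjunct in the cases \<open>ImpI\<close>, \<open>AllOI\<close>
  and \<open>AllAI\<close>: the substituted hypotheses are theorems by \<open>FP_imp_proves\<close>,
  and cut removes them.\<close>

lemma proves_fsubst_if_FP:
  assumes "is_model T M" "derives T n \<Gamma> \<Delta> \<phi>" "sorted_subst T n \<Gamma> 0 [] \<sigma> \<tau>"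
    and "\<forall>\<delta>\<in>\<Delta>. wf_fm T n \<Gamma> \<delta> \<and> FP T M (fsubst \<sigma> \<tau> \<delta>)"
  shows "T \<turnstile> fsubst \<sigma> \<tau> \<phi>"
proof -
  have "derives T 0 [] (fsubst \<sigma> \<tau> ` \<Delta>) (fsubst \<sigma> \<tau> \<phi>)"
    using assms(2,3) by (blast intro: derives_fsubst)
  moreover have "\<forall>\<delta>\<in>\<Delta>. T \<turnstile> fsubst \<sigma> \<tau> \<delta>"
    using assms by (blast intro: FP_imp_proves wf_fm_fsubst)
  ultimately show ?thesis
    unfolding proves_def derivable_from_def by (blast intro: derives_cut)
qed

text \<open>Generalizing over closed substitutions lets the quantifier cases extend
  \<open>\<sigma>\<close> or \<open>\<tau>\<close> by an arbitrary closed term. The derivation uses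
  only \<open>\<Delta>\<close>; the axioms of \<open>T\<close> enter through the provability
  conjuncts of \<open>FP\<close>.\<close>

lemma FP_fsubst_derives:
  assumes M: "is_model T M" and "derives T n \<Gamma> \<Delta> \<phi>" "sorted_subst T n \<Gamma> 0 [] \<sigma> \<tau>"
    and "\<forall>\<delta>\<in>\<Delta>. wf_fm T n \<Gamma> \<delta> \<and> FP T M (fsubst \<sigma> \<tau> \<delta>)"
  shows "FP T M (fsubst \<sigma> \<tau> \<phi>)"
  using assms(2-)
proof (induction arbitrary: \<sigma> \<tau> rule: derives.induct)
  case (EqAx \<phi> n \<Gamma> \<Delta>)
  then show ?case by (simp add: fsubst_equality_axiom FP_equality_axiom[OF M])
next
  case (OrE n \<Gamma> \<Delta> \<phi> \<psi> \<chi>)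
  have "wf_fm T n \<Gamma> \<phi>" "wf_fm T n \<Gamma> \<psi>"
    using derives_wf[OF OrE.hyps(1)] by simp_all
  moreover have "FP T M (fsubst \<sigma> \<tau> \<phi>) \<or> FP T M (fsubst \<sigma> \<tau> \<psi>)"
    using OrE.IH(1)[OF OrE.prems] by simp
  ultimately show ?case
    using OrE.IH(2,3) OrE.prems by (metis insertE)
next
  case (ImpI n \<Gamma> \<phi> \<Delta> \<psi>)
  have "T \<turnstile> fsubst \<sigma> \<tau> (Imp \<phi> \<psi>)"
    by (rule proves_fsubst_if_FP[OF M derives.ImpI[OF ImpI.hyps] ImpI.prems])
  moreover have "FP T M (fsubst \<sigma> \<tau> \<psi>)" if "FP T M (fsubst \<sigma> \<tau> \<phi>)"
    using that ImpI by auto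
  ultimately show ?case by simp
next
  case (AllOI n \<Gamma> \<Delta> \<phi>)
  have "T \<turnstile> fsubst \<sigma> \<tau> (AllO \<phi>)"
    by (rule proves_fsubst_if_FP[OF M derives.AllOI[OF AllOI.hyps] AllOI.prems])
  \<comment> \<open>The eigenvariable takes the value \<open>X\<close>; the weakened hypotheses do
    not see it and so keep \<open>FP\<close>.\<close>
  moreover have "FP T M (fsubst (case_nat X \<sigma>) \<tau> \<phi>)" if "closed_obj T X" for X
    using that AllOI.prems
    by (intro AllOI.IH sorted_subst_case_obj) (auto intro: wf_fm_weaken_obj)
  ultimately show ?case by (simp add: inst_obj_lift)
next
  case (AllOE n \<Gamma> \<Delta> \<phi> X)
  then show ?case
    using AllOE.IH[OF AllOE.prems] wf_obj_osubst[OF AllOE.hyps(2) AllOE.prems(1)]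
    by (simp add: inst_obj_lift fsubst_inst_obj)
next
  case (ExOI n \<Gamma> \<phi> X \<Delta>)
  then show ?case
    using ExOI.IH[OF ExOI.prems] wf_obj_osubst[OF ExOI.hyps(2) ExOI.prems(1)]
    by (auto simp: inst_obj_lift fsubst_inst_obj)
next
  case (ExOE n \<Gamma> \<Delta> \<phi> \<chi>)
  have "wf_fm T (Suc n) (ctx_shift \<Gamma>) \<phi>"
    using derives_wf[OF ExOE.hyps(1)] by simp
  \<comment> \<open>The witness provided by \<open>FP\<close> of the existential becomes the value
    of the eigenvariable, which \<open>weaken_obj \<chi>\<close> ignores.\<close>
  moreover obtain X where X: "closed_obj T X" "FP T M (fsubst (case_nat X \<sigma>) \<tau> \<phi>)"
    using ExOE.IH(1)[OF ExOE.prems] by (auto simp: inst_obj_lift)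
  ultimately have "FP T M (fsubst (case_nat X \<sigma>) \<tau> (weaken_obj \<chi>))"
    using ExOE.prems by (intro ExOE.IH(2) sorted_subst_case_obj) (auto intro: wf_fm_weaken_obj)
  then show ?case by simp
next
  case (AllAI n X Y \<Gamma> \<Delta> \<phi>)
  have "T \<turnstile> fsubst \<sigma> \<tau> (AllA X Y \<phi>)"
    by (rule proves_fsubst_if_FP[OF M derives.AllAI[OF AllAI.hyps] AllAI.prems])
  moreover have "FP T M (fsubst \<sigma> (case_nat t \<tau>) \<phi>)"
    if "closed_arr T t (osubst \<sigma> X) (osubst \<sigma> Y)" for t
    using that AllAI.prems
    by (intro AllAI.IH sorted_subst_case_arr) (auto intro: wf_fm_weaken_arr)
  ultimately show ?case by (simp add: inst_arr_lift)
next
  case (AllAE n \<Gamma> \<Delta> X Y \<phi> t)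
  then show ?case
    using AllAE.IH[OF AllAE.prems] has_sort_asubst[OF AllAE.hyps(2) AllAE.prems(1)]
    by (simp add: inst_arr_lift fsubst_inst_arr)
next
  case (ExAI n \<Gamma> X Y \<phi> t \<Delta>)
  then show ?case
    using ExAI.IH[OF ExAI.prems] has_sort_asubst[OF ExAI.hyps(2) ExAI.prems(1)]
    by (auto simp: inst_arr_lift fsubst_inst_arr)
next
  case (ExAE n \<Gamma> \<Delta> X Y \<phi> \<chi>)
  have "wf_fm T n ((X, Y) # \<Gamma>) \<phi>"
    using derives_wf[OF ExAE.hyps(1)] by simp
  moreover obtain t where t: "closed_arr T t (osubst \<sigma> X) (osubst \<sigma> Y)"
    "FP T M (fsubst \<sigma> (case_nat t \<tau>) \<phi>)"
    using ExAE.IH(1)[OF ExAE.prems] by (auto simp: inst_arr_lift)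
  ultimately have "FP T M (fsubst \<sigma> (case_nat t \<tau>) (weaken_arr \<chi>))"
    using ExAE.prems by (intro ExAE.IH(2) sorted_subst_case_arr) (auto intro: wf_fm_weaken_arr)
  then show ?case by simp
qed auto

theorem mainTheorem6:
  fixes T :: "('o, 'a) cat_theory" and M :: "('o, 'a) fm set"
    and \<phi>s :: "('o, 'a) fm list" and \<psi> :: "('o, 'a) fm"
  assumes "is_theory T" and "is_model T M"
    and "set \<phi>s \<subseteq> {\<phi>. sentence T \<phi> \<and> FP T M \<phi>}"
    and "derivable_from T (set \<phi>s) \<psi>"
  shows "\<psi> \<in> {\<phi>. sentence T \<phi> \<and> FP T M \<phi>}"
proof -
  have "derives T 0 [] (set \<phi>s) \<psi>"
    using assms(4) by (simp add: derivable_from_def)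
  \<comment> \<open>In the empty context the identity is already a closed substitution.\<close>
  moreover from this have "FP T M (fsubst OVar AVar \<psi>)"
    using assms(2,3) by (intro FP_fsubst_derives[OF _ _ sorted_subst_Var]) auto
  ultimately show ?thesis by (simp add: derives_wf)
qed

end
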